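(* Let $X$ be a complex Banach space, $m,r,n\in\mathbb N$ (so $n\ge1$), let $t_1<t_2<\dots<t_m$ be real and $a_{jk}$ ($1\le j\le m$, $0\le k\le n$) complex $r\times r$ matrices such that $t\mapsto\det\big(\sum_{j=1}^m a_{jn}e^{i t_jt}\big)$ is not identically $0$ on $\mathbb R$. Assume there is an index $j_0$ with $t_{j_0}=0$ and $a_{jn}=0$ for all $j\ne j_0$. Let $y:\mathbb R\to X^r$ be a solution on $\mathbb R$ of $$\sum_{k=0}^n\sum_{j=1}^m a_{jk}\,y^{(k)}(t+t_j)=f(t)$$ with $f\in\mathcal M C_u(\mathbb R,X^r)$, and assume there are $s,s^*\in\mathbb N_0$ with $y\in\big(\mathcal M^sC_u(\mathbb R,X^r)\big)\cap\mathcal M^{s^*}REC(\mathbb R,X^r)$. Then $y^{(k)}\in REC(\mathbb R,X^r)$ for $0\le k<n$ and $y^{(n)}\in\mathcal M REC(\mathbb R,X^r)$.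
   Context: $C_u(\mathbb R,Y)$: uniformly continuous functions (not necessarily bounded). $L^1_{loc}(\mathbb R,Y)$: locally Bochner integrable functions. $M_hf(t)=\frac1h\int_0^hf(t+s)\,ds$; for a set $\mathcal A$ of functions $\mathbb R\to Y$: $\mathcal M\mathcal A=\{f\in L^1_{loc}(\mathbb R,Y): M_hf\in\mathcal A\text{ for all }h>0\}$, $\mathcal M^0\mathcal A=\mathcal A\cap L^1_{loc}(\mathbb R,Y)$, $\mathcal M^k\mathcal A=\mathcal M(\mathcal M^{k-1}\mathcal A)$. A continuous $f:\mathbb R\to Y$ is recurrent if for each compact $K\subset\mathbb R$ and $\varepsilon>0$ the set $E(f,\varepsilon,K)=\{\tau\in\mathbb R:\|f(t+\tau)-f(t)\|\le\varepsilon\ \forall t\in K\}$ is relatively dense, i.e. there is a compact $L\subset\mathbb R$ with $E(f,\varepsilon,K)+L=\mathbb R$; $REC(\mathbb R,Y)$ is the set of recurrent functions. Solution: $y\in W^{1,n}_{loc}(\mathbb R,X^r)$ (i.e. $y\in C^{n-1}$ and $y^{(n-1)}$ is an indefinite Bochner integral of a function $y^{(n)}\in L^1_{loc}$) and the equation holds a.e. on $\mathbb R$; $y,f$ are column vectors. *)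

theory Defs
  imports "HOL-Analysis.Analysis"
begin

class complex_banach = banach +
  fixes scaleC :: "complex \<Rightarrow> 'a \<Rightarrow> 'a"  (infixr \<open>*\<^sub>C\<close> 75)
  assumes scaleC_add_right: "c *\<^sub>C (x + y) = c *\<^sub>C x + c *\<^sub>C y"
    and scaleC_add_left: "(c + d) *\<^sub>C x = c *\<^sub>C x + d *\<^sub>C x"
    and scaleC_scaleC: "c *\<^sub>C d *\<^sub>C x = (c * d) *\<^sub>C x"
    and scaleC_of_real: "complex_of_real b *\<^sub>C x = b *\<^sub>R x"
    and norm_scaleC: "norm (c *\<^sub>C x) = cmod c * norm x"

instantiation complex :: complex_banach
begin
definition scaleC_complex :: "complex \<Rightarrow> complex \<Rightarrow> complex" where
  "scaleC_complex c x = c * x"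
instance
  by standard (simp_all add: scaleC_complex_def algebra_simps norm_mult scaleR_conv_of_real)
end

text \<open>A complex \<open>r \<times> r\<close> matrix acting on column vectors with entries in the space; the space of
  column vectors carries the library's Euclidean combination of the component norms.\<close>

definition mat_act :: "complex ^ 'r ^ 'r \<Rightarrow> 'x::complex_banach ^ 'r \<Rightarrow> 'x ^ 'r"  (infixr \<open>*\<^sub>M\<close> 75)
  where "A *\<^sub>M v = (\<chi> p. \<Sum>q\<in>UNIV. A $ p $ q *\<^sub>C v $ q)"

text \<open>The library's \<^const>\<open>has_bochner_integral\<close> is restricted to second countable (hence separable)
  spaces. The definition below is the same one without that restriction. For a complete
  measure, approximability by simple functions in mean forces strong measurability.\<close>

definition has_Bochner_int :: "'a measure \<Rightarrow> ('a \<Rightarrow> 'b::banach) \<Rightarrow> 'b \<Rightarrow> bool" where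
  "has_Bochner_int M f x \<longleftrightarrow>
     f \<in> borel_measurable M \<and>
     (\<exists>s. (\<forall>i. Bochner_Integration.simple_bochner_integrable M (s i)) \<and>
          (\<lambda>i. \<integral>\<^sup>+w. ennreal (norm (f w - s i w)) \<partial>M) \<longlonglongrightarrow> 0 \<and>
          (\<lambda>i. Bochner_Integration.simple_bochner_integral M (s i)) \<longlonglongrightarrow> x)"

lemma has_Bochner_int_iff_has_bochner_integral:
  fixes f :: "'a \<Rightarrow> 'b::{banach, second_countable_topology}"
  shows "has_Bochner_int M f x \<longleftrightarrow> has_bochner_integral M f x"
  unfolding has_Bochner_int_def has_bochner_integral.simps by auto

lemma has_Bochner_int_unique:
  assumes "has_Bochner_int M f x" "has_Bochner_int M f y"
  shows "x = y"
proof -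
  obtain s where f: "f \<in> borel_measurable M"
    and s: "\<And>i. Bochner_Integration.simple_bochner_integrable M (s i)"
      "(\<lambda>i. \<integral>\<^sup>+w. ennreal (norm (f w - s i w)) \<partial>M) \<longlonglongrightarrow> 0"
      "(\<lambda>i. Bochner_Integration.simple_bochner_integral M (s i)) \<longlonglongrightarrow> x"
    using assms(1) unfolding has_Bochner_int_def by auto
  obtain u where u: "\<And>i. Bochner_Integration.simple_bochner_integrable M (u i)"
      "(\<lambda>i. \<integral>\<^sup>+w. ennreal (norm (f w - u i w)) \<partial>M) \<longlonglongrightarrow> 0"
      "(\<lambda>i. Bochner_Integration.simple_bochner_integral M (u i)) \<longlonglongrightarrow> y"
    using assms(2) unfolding has_Bochner_int_def by auto
  have meas: "(\<lambda>w. ennreal (norm (f w - v w))) \<in> borel_measurable M"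
    if "Bochner_Integration.simple_bochner_integrable M v" for v :: "'a \<Rightarrow> 'b"
  proof -
    have v: "simple_function M v" using that by (auto elim: Bochner_Integration.simple_bochner_integrable.cases)
    show ?thesis
    proof (rule measurable_compose_countable'[where f = "\<lambda>c w. ennreal (norm (f w - c))" and g = v and I = "v ` space M"])
      show "(\<lambda>w. ennreal (norm (f w - c))) \<in> borel_measurable M" for c
      proof -
        have "(\<lambda>a. norm (a - c)) \<in> borel_measurable borel"
          by (intro borel_measurable_continuous_onI continuous_intros)
        from measurable_compose[OF f this] show ?thesis
          by (rule measurable_compose[OF _ measurable_ennreal])
      qed
      show "v \<in> M \<rightarrow>\<^sub>M count_space (v ` space M)"
        using v by (auto simp: measurable_count_space_eq2 simple_function_def)
      show "countable (v ` space M)"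
        using v by (auto simp: simple_function_def intro: countable_finite)
    qed
  qed
  have le: "ennreal (norm (Bochner_Integration.simple_bochner_integral M (s i) - Bochner_Integration.simple_bochner_integral M (u i)))
      \<le> (\<integral>\<^sup>+w. ennreal (norm (f w - s i w)) \<partial>M) + (\<integral>\<^sup>+w. ennreal (norm (f w - u i w)) \<partial>M)" for i
  proof -
    have su: "Bochner_Integration.simple_bochner_integrable M (\<lambda>w. s i w - u i w)"
      by (rule simple_bochner_integrable_compose2[where p = "(-)"]) (auto simp: s u)
    have "norm (Bochner_Integration.simple_bochner_integral M (s i) - Bochner_Integration.simple_bochner_integral M (u i))
        = norm (Bochner_Integration.simple_bochner_integral M (\<lambda>w. s i w - u i w))"
      by (simp add: simple_bochner_integral_diff s u)
    also have "\<dots> \<le> Bochner_Integration.simple_bochner_integral M (\<lambda>w. norm (s i w - u i w))"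
      by (rule simple_bochner_integral_norm_bound[OF su])
    also have "ennreal \<dots> = (\<integral>\<^sup>+w. ennreal (norm (s i w - u i w)) \<partial>M)"
      using su by (intro simple_bochner_integral_eq_nn_integral)
        (auto intro: simple_bochner_integrable_compose2[where p="\<lambda>x y. norm (x - y)"] s u)
    also have "\<dots> \<le> (\<integral>\<^sup>+w. ennreal (norm (f w - s i w)) + ennreal (norm (f w - u i w)) \<partial>M)"
    proof (rule nn_integral_mono)
      fix w
      have "norm (s i w - u i w) \<le> norm (f w - s i w) + norm (f w - u i w)"
        by (metis dist_norm dist_triangle2 norm_minus_commute)
      then show "ennreal (norm (s i w - u i w)) \<le> ennreal (norm (f w - s i w)) + ennreal (norm (f w - u i w))"
        by (simp flip: ennreal_plus)
    qed
    also have "\<dots> = (\<integral>\<^sup>+w. ennreal (norm (f w - s i w)) \<partial>M) + (\<integral>\<^sup>+w. ennreal (norm (f w - u i w)) \<partial>M)"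
      by (rule nn_integral_add[OF meas[OF s(1)] meas[OF u(1)]])
    finally show ?thesis by (simp add: ennreal_leI)
  qed
  have "(\<lambda>i. ennreal (norm (Bochner_Integration.simple_bochner_integral M (s i) - Bochner_Integration.simple_bochner_integral M (u i)))) \<longlonglongrightarrow> 0"
    by (rule tendsto_sandwich[OF _ always_eventually[OF allI[OF le]] tendsto_const])
       (use tendsto_add[OF s(2) u(2)] in simp_all)
  moreover have "(\<lambda>i. ennreal (norm (Bochner_Integration.simple_bochner_integral M (s i) - Bochner_Integration.simple_bochner_integral M (u i))))
      \<longlonglongrightarrow> ennreal (norm (x - y))"
    by (intro tendsto_ennrealI tendsto_norm tendsto_diff s u)
  ultimately have "ennreal (norm (x - y)) = 0"
    using LIMSEQ_unique by blast
  then show ?thesis by (simp add: ennreal_eq_0_iff)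
qed

definition Bochner_integrable :: "'a measure \<Rightarrow> ('a \<Rightarrow> 'b::banach) \<Rightarrow> bool" where
  "Bochner_integrable M f \<longleftrightarrow> (\<exists>x. has_Bochner_int M f x)"

definition Bochner_int :: "'a measure \<Rightarrow> ('a \<Rightarrow> 'b::banach) \<Rightarrow> 'b" where
  "Bochner_int M f = (THE x. has_Bochner_int M f x)"

text \<open>Elements of the locally integrable class are functions, not equivalence classes.\<close>

definition L1_loc :: "(real \<Rightarrow> 'b::banach) set" where
  "L1_loc = {f. \<forall>u v. Bochner_integrable (lebesgue_on {u..v}) f}"

definition C_u :: "(real \<Rightarrow> 'b::banach) set" where
  "C_u = {f. uniformly_continuous_on UNIV f}"

definition Mean :: "real \<Rightarrow> (real \<Rightarrow> 'b::banach) \<Rightarrow> real \<Rightarrow> 'b" where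
  "Mean h f t = (1 / h) *\<^sub>R Bochner_int (lebesgue_on {0..h}) (\<lambda>s. f (t + s))"

definition MM :: "(real \<Rightarrow> 'b::banach) set \<Rightarrow> (real \<Rightarrow> 'b) set" where
  "MM A = {f \<in> L1_loc. \<forall>h>0. Mean h f \<in> A}"

primrec MM_pow :: "nat \<Rightarrow> (real \<Rightarrow> 'b::banach) set \<Rightarrow> (real \<Rightarrow> 'b) set" where
  "MM_pow 0 A = A \<inter> L1_loc"
| "MM_pow (Suc k) A = MM (MM_pow k A)"

definition almost_periods :: "(real \<Rightarrow> 'b::banach) \<Rightarrow> real \<Rightarrow> real set \<Rightarrow> real set" where
  "almost_periods f \<epsilon> K = {\<tau>. \<forall>t\<in>K. norm (f (t + \<tau>) - f t) \<le> \<epsilon>}"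

definition relatively_dense :: "real set \<Rightarrow> bool" where
  "relatively_dense E \<longleftrightarrow> (\<exists>L. compact L \<and> {\<tau> + l | \<tau> l. \<tau> \<in> E \<and> l \<in> L} = UNIV)"

definition REC :: "(real \<Rightarrow> 'b::banach) set" where
  "REC = {f. continuous_on UNIV f \<and>
     (\<forall>K \<epsilon>. compact K \<longrightarrow> \<epsilon> > 0 \<longrightarrow> relatively_dense (almost_periods f \<epsilon> K))}"

text \<open>\<open>W_loc_derivs n y D\<close>, for \<open>n \<ge> 1\<close>: the function \<open>y\<close> lies in the local Sobolev space of
  order \<open>n\<close> and \<open>D k\<close> is its \<open>k\<close>-th derivative for \<open>k \<le> n\<close>. The top derivative \<open>D n\<close> is determined
  only almost everywhere; any representative is allowed.\<close>

definition W_loc_derivs :: "nat \<Rightarrow> (real \<Rightarrow> 'b::banach) \<Rightarrow> (nat \<Rightarrow> real \<Rightarrow> 'b) \<Rightarrow> bool" where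
  "W_loc_derivs n y D \<longleftrightarrow>
     D 0 = y \<and>
     (\<forall>k<n. continuous_on UNIV (D k)) \<and>
     (\<forall>k. Suc k < n \<longrightarrow> (\<forall>x. (D k has_vector_derivative D (Suc k) x) (at x))) \<and>
     D n \<in> L1_loc \<and>
     (\<forall>u v. u \<le> v \<longrightarrow> D (n - 1) v - D (n - 1) u = Bochner_int (lebesgue_on {u..v}) (D n))"

definition is_solution ::
  "nat \<Rightarrow> nat \<Rightarrow> (nat \<Rightarrow> real) \<Rightarrow> (nat \<Rightarrow> nat \<Rightarrow> complex ^ 'r ^ 'r) \<Rightarrow> (real \<Rightarrow> 'x::complex_banach ^ 'r)
    \<Rightarrow> (real \<Rightarrow> 'x ^ 'r) \<Rightarrow> (nat \<Rightarrow> real \<Rightarrow> 'x ^ 'r) \<Rightarrow> bool" where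
  "is_solution n m t a f y D \<longleftrightarrow>
     W_loc_derivs n y D \<and>
     (AE x in lebesgue. (\<Sum>k = 0..n. \<Sum>j = 1..m. a j k *\<^sub>M D k (x + t j)) = f x)"

end

theory Submission
  imports Defs
begin

text \<open>
  The leading coefficient is a single undelayed matrix, invertible by the determinant condition, so
  the equation expresses \<open>D n\<close> through \<open>f\<close> and shifts of the lower derivatives. Recurrence passes
  from a function to its difference quotients and to uniform limits, but not to sums of recurrent
  functions. The equation is therefore used only to show that \<open>D 0, \<dots>, D (n - 1)\<close> are uniformly
  continuous, and recurrence is obtained from \<open>y\<close> alone.

  Uniform continuity rests on a Tauberian lemma (\<open>C_u_of_differences\<close>, proved with Baire's
  theorem): a continuous \<open>F\<close> is uniformly continuous as soon as all its means \<open>Mean h F\<close> and all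
  its differences \<open>F(x + h) - F(x)\<close> are. Taking means lifts it to the iterated classes: if \<open>F\<close> lies
  in \<open>MM_pow (p + 1) C_u\<close> and its differences lie in \<open>MM_pow p C_u\<close>, then \<open>F\<close> lies in
  \<open>MM_pow p C_u\<close>. Since \<open>h Mean h (D (k + 1))\<close> is the difference of \<open>D k\<close>, all \<open>D k\<close> with \<open>k < n\<close>
  lie in \<open>MM_pow (s + n) C_u\<close>. If they all lie in \<open>MM_pow (p + 1) C_u\<close>, then their differences lie
  in \<open>MM_pow p C_u\<close>: for \<open>k < n - 1\<close> because the difference of \<open>D k\<close> is a multiple of a mean of
  \<open>D (k + 1)\<close>, and for \<open>k = n - 1\<close> because the integrated equation writes the difference as a linear
  combination of means of \<open>f\<close> and of shifted lower derivatives. The exponent thus descends to \<open>0\<close>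
  (\<open>solution_derivs_C_u\<close>).

  A uniformly continuous function is the uniform limit of its means as \<open>h\<close> tends to \<open>0\<close>. Hence \<open>y\<close>
  is recurrent because its iterated means are (\<open>REC_of_MM_pow\<close>). If \<open>D k\<close> is recurrent with
  \<open>k < n\<close>, then so are the means of \<open>D (k + 1)\<close>, being difference quotients of \<open>D k\<close>, and therefore
  \<open>D (k + 1)\<close> itself when \<open>k + 1 < n\<close>.
\<close>

section \<open>The Bochner integral without separability\<close>

text \<open>A simple function takes finitely many values, and for each fixed value \<open>c\<close> the function
  \<open>norm (f w - c)\<close> is a continuous image of \<open>f\<close>; subtraction on the whole space, which is not
  Borel measurable in general, is avoided.\<close>

lemma borel_measurable_norm_diff_simple:
  assumes f: "f \<in> borel_measurable M"
    and v: "Bochner_Integration.simple_bochner_integrable M v"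
  shows "(\<lambda>w. ennreal (norm (f w - v w))) \<in> borel_measurable M"
proof (rule measurable_compose_countable'[where f = "\<lambda>c w. ennreal (norm (f w - c))" and g = v and I = "v ` space M"])
  have sv: "simple_function M v"
    using v by (auto elim: Bochner_Integration.simple_bochner_integrable.cases)
  show "(\<lambda>w. ennreal (norm (f w - c))) \<in> borel_measurable M" for c
  proof -
    have "(\<lambda>a. norm (a - c)) \<in> borel_measurable borel"
      by (intro borel_measurable_continuous_onI continuous_intros)
    from measurable_compose[OF f this] show ?thesis
      by (rule measurable_compose[OF _ measurable_ennreal])
  qed
  show "v \<in> M \<rightarrow>\<^sub>M count_space (v ` space M)"
    using sv by (auto simp: measurable_count_space_eq2 simple_function_def)
  show "countable (v ` space M)"
    using sv by (auto simp: simple_function_def intro: countable_finite)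
qed

text \<open>In a nonseparable space a sum of Borel functions need not be Borel, so additivity is stated
  for a function already known to have an integral. The integral of the difference
  of the simple approximations is at most the sum of their three mean errors.\<close>

lemma has_Bochner_int_add_AE:
  assumes "has_Bochner_int M f x" "has_Bochner_int M g y" "has_Bochner_int M h z"
    and ae: "AE w in M. f w = g w + h w"
  shows "x = y + z"
proof -
  obtain s where f: "f \<in> borel_measurable M"
    and s: "\<And>i. Bochner_Integration.simple_bochner_integrable M (s i)"
      "(\<lambda>i. \<integral>\<^sup>+w. ennreal (norm (f w - s i w)) \<partial>M) \<longlonglongrightarrow> 0"
      "(\<lambda>i. Bochner_Integration.simple_bochner_integral M (s i)) \<longlonglongrightarrow> x"
    using assms(1) unfolding has_Bochner_int_def by auto
  obtain u where g: "g \<in> borel_measurable M"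
    and u: "\<And>i. Bochner_Integration.simple_bochner_integrable M (u i)"
      "(\<lambda>i. \<integral>\<^sup>+w. ennreal (norm (g w - u i w)) \<partial>M) \<longlonglongrightarrow> 0"
      "(\<lambda>i. Bochner_Integration.simple_bochner_integral M (u i)) \<longlonglongrightarrow> y"
    using assms(2) unfolding has_Bochner_int_def by auto
  obtain v where h: "h \<in> borel_measurable M"
    and v: "\<And>i. Bochner_Integration.simple_bochner_integrable M (v i)"
      "(\<lambda>i. \<integral>\<^sup>+w. ennreal (norm (h w - v i w)) \<partial>M) \<longlonglongrightarrow> 0"
      "(\<lambda>i. Bochner_Integration.simple_bochner_integral M (v i)) \<longlonglongrightarrow> z"
    using assms(3) unfolding has_Bochner_int_def by auto
  let ?I = "Bochner_Integration.simple_bochner_integral M"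
  define d where "d i = ?I (s i) - (?I (u i) + ?I (v i))" for i
  have le: "ennreal (norm (d i))
      \<le> (\<integral>\<^sup>+w. ennreal (norm (f w - s i w)) \<partial>M) +
        ((\<integral>\<^sup>+w. ennreal (norm (g w - u i w)) \<partial>M) + (\<integral>\<^sup>+w. ennreal (norm (h w - v i w)) \<partial>M))" for i
  proof -
    have uv: "Bochner_Integration.simple_bochner_integrable M (\<lambda>w. u i w + v i w)"
      by (rule simple_bochner_integrable_compose2[where p = "(+)"]) (auto simp: u v)
    have suv: "Bochner_Integration.simple_bochner_integrable M (\<lambda>w. s i w - (u i w + v i w))"
      by (rule simple_bochner_integrable_compose2[where p = "(-)"]) (auto simp: s uv)
    have "norm (d i) = norm (?I (\<lambda>w. s i w - (u i w + v i w)))"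
      by (simp add: d_def simple_bochner_integral_diff simple_bochner_integral_add s u v uv)
    also have "\<dots> \<le> ?I (\<lambda>w. norm (s i w - (u i w + v i w)))"
      by (rule simple_bochner_integral_norm_bound[OF suv])
    also have "ennreal \<dots> = (\<integral>\<^sup>+w. ennreal (norm (s i w - (u i w + v i w))) \<partial>M)"
      by (intro simple_bochner_integral_eq_nn_integral
          simple_bochner_integrable_compose2[where p = "\<lambda>a b. norm (a - b)"] s uv) auto
    also have "\<dots> \<le> (\<integral>\<^sup>+w. ennreal (norm (f w - s i w)) +
        (ennreal (norm (g w - u i w)) + ennreal (norm (h w - v i w))) \<partial>M)"
    proof (rule nn_integral_mono_AE, use ae in eventually_elim)
      fix w assume fw: "f w = g w + h w"
      have "s i w - (u i w + v i w) = (g w - u i w) + (h w - v i w) - (f w - s i w)"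
        by (simp add: fw)
      then have "norm (s i w - (u i w + v i w))
          \<le> norm (f w - s i w) + (norm (g w - u i w) + norm (h w - v i w))"
        by (smt (verit) norm_triangle_ineq norm_triangle_ineq4)
      then show "ennreal (norm (s i w - (u i w + v i w)))
          \<le> ennreal (norm (f w - s i w)) + (ennreal (norm (g w - u i w)) + ennreal (norm (h w - v i w)))"
        by (simp flip: ennreal_plus)
    qed
    also have "\<dots> = (\<integral>\<^sup>+w. ennreal (norm (f w - s i w)) \<partial>M) +
        ((\<integral>\<^sup>+w. ennreal (norm (g w - u i w)) \<partial>M) + (\<integral>\<^sup>+w. ennreal (norm (h w - v i w)) \<partial>M))"
      by (simp only: nn_integral_add borel_measurable_add borel_measurable_norm_diff_simple f g h s(1) u(1) v(1))
    finally show ?thesis by (simp add: ennreal_leI)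
  qed
  have "(\<lambda>i. ennreal (norm (d i))) \<longlonglongrightarrow> 0"
    by (rule tendsto_sandwich[OF _ always_eventually[OF allI[OF le]] tendsto_const])
       (use tendsto_add[OF s(2) tendsto_add[OF u(2) v(2)]] in simp_all)
  moreover have "(\<lambda>i. ennreal (norm (d i))) \<longlonglongrightarrow> ennreal (norm (x - (y + z)))"
    unfolding d_def by (intro tendsto_ennrealI tendsto_intros s u v)
  ultimately have "ennreal (norm (x - (y + z))) = 0"
    using LIMSEQ_unique by blast
  then show ?thesis by (simp add: ennreal_eq_0_iff)
qed

lemma has_Bochner_int_bounded_linear:
  assumes L: "bounded_linear L" and f: "has_Bochner_int M f x"
  shows "has_Bochner_int M (\<lambda>w. L (f w)) (L x)"
proof -
  interpret L: bounded_linear L by fact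
  obtain s where fm: "f \<in> borel_measurable M"
    and s: "\<And>i. Bochner_Integration.simple_bochner_integrable M (s i)"
      "(\<lambda>i. \<integral>\<^sup>+w. ennreal (norm (f w - s i w)) \<partial>M) \<longlonglongrightarrow> 0"
      "(\<lambda>i. Bochner_Integration.simple_bochner_integral M (s i)) \<longlonglongrightarrow> x"
    using f unfolding has_Bochner_int_def by auto
  obtain K where K: "K > 0" "\<And>a. norm (L a) \<le> norm a * K"
    using L.pos_bounded by auto
  have "L \<in> borel_measurable borel"
    by (intro borel_measurable_continuous_onI L.continuous_on continuous_on_id)
  from measurable_compose[OF fm this]
  have meas: "(\<lambda>w. L (f w)) \<in> borel_measurable M" .
  have Ls: "Bochner_Integration.simple_bochner_integrable M (\<lambda>w. L (s i w))" for i
    by (rule simple_bochner_integrable_compose2[where p = "\<lambda>a b. L a" and g = "s i"])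
       (auto simp: s L.zero)
  have le: "(\<integral>\<^sup>+w. ennreal (norm (L (f w) - L (s i w))) \<partial>M)
      \<le> ennreal K * (\<integral>\<^sup>+w. ennreal (norm (f w - s i w)) \<partial>M)" for i
  proof -
    have "(\<integral>\<^sup>+w. ennreal (norm (L (f w) - L (s i w))) \<partial>M)
        \<le> (\<integral>\<^sup>+w. ennreal K * ennreal (norm (f w - s i w)) \<partial>M)"
      using K by (intro nn_integral_mono)
        (simp add: L.diff[symmetric] mult.commute ennreal_leI flip: ennreal_mult)
    also have "\<dots> = ennreal K * (\<integral>\<^sup>+w. ennreal (norm (f w - s i w)) \<partial>M)"
      by (rule nn_integral_cmult[OF borel_measurable_norm_diff_simple[OF fm s(1)]])
    finally show ?thesis .
  qed
  have "(\<lambda>i. \<integral>\<^sup>+w. ennreal (norm (L (f w) - L (s i w))) \<partial>M) \<longlonglongrightarrow> 0"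
  proof (rule tendsto_sandwich[OF _ always_eventually[OF allI[OF le]] tendsto_const])
    show "(\<lambda>i. ennreal K * (\<integral>\<^sup>+w. ennreal (norm (f w - s i w)) \<partial>M)) \<longlonglongrightarrow> 0"
      using ennreal_tendsto_cmult[OF _ s(2), of "ennreal K"] by simp
  qed simp
  moreover have "(\<lambda>i. Bochner_Integration.simple_bochner_integral M (\<lambda>w. L (s i w))) \<longlonglongrightarrow> L x"
    using L.tendsto[OF s(3)] by (simp add: simple_bochner_integral_linear[OF L.linear s(1)])
  ultimately show ?thesis
    unfolding has_Bochner_int_def using meas Ls by (intro conjI exI[of _ "\<lambda>i w. L (s i w)"]) auto
qed

text \<open>Simple approximations are pulled back along \<open>T\<close>. A value attained on \<open>N\<close> but not on the range of
  \<open>T\<close> has an empty preimage and drops out of the sum that defines the integral.\<close>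

lemma has_Bochner_int_distr:
  assumes T: "T \<in> measurable M N" and f: "has_Bochner_int (distr M N T) f x"
  shows "has_Bochner_int M (\<lambda>w. f (T w)) x"
proof -
  let ?D = "distr M N T"
  have TD: "T \<in> measurable M ?D" using T by simp
  obtain s where fm: "f \<in> borel_measurable ?D"
    and s: "\<And>i. Bochner_Integration.simple_bochner_integrable ?D (s i)"
      "(\<lambda>i. \<integral>\<^sup>+w. ennreal (norm (f w - s i w)) \<partial>?D) \<longlonglongrightarrow> 0"
      "(\<lambda>i. Bochner_Integration.simple_bochner_integral ?D (s i)) \<longlonglongrightarrow> x"
    using f unfolding has_Bochner_int_def by auto
  have sf: "simple_function ?D (s i)" for i
    using s(1) by (auto elim: Bochner_Integration.simple_bochner_integrable.cases)
  have pre: "T -` {w \<in> space N. P w} \<inter> space M = {w \<in> space M. P (T w)}" for P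
    using measurable_space[OF T] by auto
  have set: "{w \<in> space N. P (s i w)} \<in> sets N" for P i
  proof -
    have "s i -` {v. P v} \<inter> space ?D \<in> sets ?D"
      using simple_functionD(2)[OF sf] .
    moreover have "s i -` {v. P v} \<inter> space ?D = {w \<in> space N. P (s i w)}" by auto
    ultimately show ?thesis by simp
  qed
  have sT: "Bochner_Integration.simple_bochner_integrable M (\<lambda>w. s i (T w))" for i
  proof
    show "simple_function M (\<lambda>w. s i (T w))"
      by (rule simple_function_comp[OF TD sf])
    have "emeasure ?D {w \<in> space ?D. s i w \<noteq> 0} \<noteq> \<infinity>"
      using s(1)[of i] by (auto elim: Bochner_Integration.simple_bochner_integrable.cases)
    moreover have "emeasure ?D {w \<in> space ?D. s i w \<noteq> 0} = emeasure M {w \<in> space M. s i (T w) \<noteq> 0}"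
      using emeasure_distr[OF T set[where P = "\<lambda>v. v \<noteq> 0"]] by (simp only: pre space_distr)
    ultimately show "emeasure M {w \<in> space M. s i (T w) \<noteq> 0} \<noteq> \<infinity>" by simp
  qed
  have meq: "measure ?D {w \<in> space ?D. s i w = v} = measure M {w \<in> space M. s i (T w) = v}" for i v
    using measure_distr[OF T set[where P = "\<lambda>a. a = v"]] by (simp only: pre space_distr)
  have int: "Bochner_Integration.simple_bochner_integral M (\<lambda>w. s i (T w))
      = Bochner_Integration.simple_bochner_integral ?D (s i)" for i
    unfolding Bochner_Integration.simple_bochner_integral_def meq
  proof (rule sum.mono_neutral_left)
    show "finite (s i ` space ?D)" using sf by (auto simp: simple_function_def)
    show "(\<lambda>w. s i (T w)) ` space M \<subseteq> s i ` space ?D"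
      using measurable_space[OF T] by auto
    show "\<forall>v\<in>s i ` space ?D - (\<lambda>w. s i (T w)) ` space M.
        measure M {x \<in> space M. s i (T x) = v} *\<^sub>R v = 0"
    proof
      fix v assume "v \<in> s i ` space ?D - (\<lambda>w. s i (T w)) ` space M"
      then have "{x \<in> space M. s i (T x) = v} = {}" by blast
      then show "measure M {x \<in> space M. s i (T x) = v} *\<^sub>R v = 0" by (simp only: measure_empty) simp
    qed
  qed
  have "(\<integral>\<^sup>+w. ennreal (norm (f w - s i w)) \<partial>?D) = (\<integral>\<^sup>+w. ennreal (norm (f (T w) - s i (T w))) \<partial>M)" for i
    by (rule nn_integral_distr[OF T borel_measurable_norm_diff_simple[OF fm s(1)]])
  then show ?thesis
    unfolding has_Bochner_int_def using measurable_compose[OF TD fm] sT s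
    by (intro conjI exI[of _ "\<lambda>i w. s i (T w)"]) (auto simp: int)
qed

lemma lebesgue_on_translation:
  fixes t u v :: real
  shows "(+) t \<in> lebesgue_on {u..v} \<rightarrow>\<^sub>M lebesgue_on {t + u..t + v}"
    and "distr (lebesgue_on {u..v}) (lebesgue_on {t + u..t + v}) ((+) t) = lebesgue_on {t + u..t + v}"
proof -
  have T: "(+) t \<in> lebesgue \<rightarrow>\<^sub>M lebesgue"
    using lebesgue_affine_measurable[of "\<lambda>_. 1" t] by (simp add: euclidean_representation)
  then show m: "(+) t \<in> lebesgue_on {u..v} \<rightarrow>\<^sub>M lebesgue_on {t + u..t + v}"
    by (intro measurable_restrict_space2 measurable_restrict_space1) auto
  have inv: "lebesgue = distr lebesgue lebesgue ((+) t)"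
    using lebesgue_real_affine[of 1 t] by (simp add: density_1)
  show "distr (lebesgue_on {u..v}) (lebesgue_on {t + u..t + v}) ((+) t) = lebesgue_on {t + u..t + v}"
  proof (rule measure_eqI)
    fix A assume "A \<in> sets (distr (lebesgue_on {u..v}) (lebesgue_on {t + u..t + v}) ((+) t))"
    then have A: "A \<in> sets (lebesgue_on {t + u..t + v})" by simp
    then have A': "A \<in> sets lebesgue" "A \<subseteq> {t + u..t + v}"
      by (auto simp: sets_restrict_space_iff)
    have "emeasure (distr (lebesgue_on {u..v}) (lebesgue_on {t + u..t + v}) ((+) t)) A
        = emeasure (lebesgue_on {u..v}) ((+) t -` A \<inter> {u..v})"
      by (simp add: emeasure_distr[OF m A])
    also have "\<dots> = emeasure lebesgue ((+) t -` A \<inter> {u..v})"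
      by (rule emeasure_restrict_space) auto
    also have "(+) t -` A \<inter> {u..v} = (+) t -` A \<inter> space lebesgue"
      using A'(2) by auto
    also have "emeasure lebesgue \<dots> = emeasure lebesgue A"
      using emeasure_distr[OF T A'(1)] inv by simp
    also have "\<dots> = emeasure (lebesgue_on {t + u..t + v}) A"
      by (rule emeasure_restrict_space[symmetric]) (use A' in auto)
    finally show "emeasure (distr (lebesgue_on {u..v}) (lebesgue_on {t + u..t + v}) ((+) t)) A
        = emeasure (lebesgue_on {t + u..t + v}) A" .
  qed simp
qed

lemma has_Bochner_int_translation:
  fixes t u v :: real
  assumes "has_Bochner_int (lebesgue_on {t + u..t + v}) f x"
  shows "has_Bochner_int (lebesgue_on {u..v}) (\<lambda>s. f (t + s)) x"
  using has_Bochner_int_distr[OF lebesgue_on_translation(1), where f = f and x = x] assms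
  by (simp add: lebesgue_on_translation(2))

lemma has_Bochner_int_Bochner_int:
  "Bochner_integrable M f \<Longrightarrow> has_Bochner_int M f (Bochner_int M f)"
  unfolding Bochner_integrable_def Bochner_int_def
  by (rule theI') (blast intro: has_Bochner_int_unique)

lemma Bochner_int_eqI: "has_Bochner_int M f x \<Longrightarrow> Bochner_int M f = x"
  unfolding Bochner_int_def by (blast intro: the_equality has_Bochner_int_unique)

text \<open>The link between the two notions of integral: the level sets of a simple function are Lebesgue
  measurable and bounded, and the Henstock-Kurzweil integral of an indicator is the measure.\<close>

lemma simple_bochner_integral_has_integral:
  fixes s :: "real \<Rightarrow> 'b::banach"
  assumes s: "simple_function (lebesgue_on {u..v}) s"
  shows "(s has_integral Bochner_Integration.simple_bochner_integral (lebesgue_on {u..v}) s) {u..v}"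
proof -
  define S where "S y = {x \<in> {u..v}. s x = y}" for y
  have fin: "finite (s ` {u..v})" using s by (simp add: simple_function_def)
  have Sm: "S y \<in> lmeasurable" for y
  proof (rule bounded_set_imp_lmeasurable)
    show "bounded (S y)" unfolding S_def by (rule bounded_subset[of "{u..v}"]) auto
    have "s -` {y} \<inter> space (lebesgue_on {u..v}) \<in> sets (lebesgue_on {u..v})"
      by (rule simple_functionD(2)[OF s])
    moreover have "s -` {y} \<inter> space (lebesgue_on {u..v}) = S y" by (auto simp: S_def)
    ultimately show "S y \<in> sets lebesgue" by (auto simp: sets_restrict_space_iff)
  qed
  have "((\<lambda>x. \<Sum>y\<in>s ` {u..v}. indicator (S y) x *\<^sub>R y) has_integral
      (\<Sum>y\<in>s ` {u..v}. measure lebesgue (S y) *\<^sub>R y)) UNIV"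
    using Sm by (intro has_integral_sum fin has_integral_scaleR_left) (simp add: lmeasurable_iff_has_integral)
  also have "(\<lambda>x. \<Sum>y\<in>s ` {u..v}. indicator (S y) x *\<^sub>R y) = (\<lambda>x. if x \<in> {u..v} then s x else 0)"
  proof
    fix x
    have "(\<Sum>y\<in>s ` {u..v}. indicator (S y) x *\<^sub>R y)
        = (\<Sum>y\<in>s ` {u..v}. if y = s x then (if x \<in> {u..v} then s x else 0) else 0)"
      by (intro sum.cong) (auto simp: S_def indicator_def)
    then show "(\<Sum>y\<in>s ` {u..v}. indicator (S y) x *\<^sub>R y) = (if x \<in> {u..v} then s x else 0)"
      using fin by (auto simp: sum.delta)
  qed
  also have "(\<Sum>y\<in>s ` {u..v}. measure lebesgue (S y) *\<^sub>R y)
      = Bochner_Integration.simple_bochner_integral (lebesgue_on {u..v}) s"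
  proof -
    have "measure (lebesgue_on {u..v}) (S y) = measure lebesgue (S y)" for y
      by (rule measure_restrict_space) (auto simp: S_def)
    then show ?thesis
      unfolding Bochner_Integration.simple_bochner_integral_def by (simp add: S_def)
  qed
  finally show ?thesis by (simp only: has_integral_restrict_UNIV)
qed

text \<open>Step functions that take the value of the integrand at the left end point of each cell of the
  grid of width \<open>1 / (i + 1)\<close> converge uniformly, whence both the Bochner and the
  Henstock-Kurzweil integral are the limit of the integrals of these step functions.\<close>

lemma has_Bochner_int_continuous:
  fixes c :: "real \<Rightarrow> 'b::banach"
  assumes c: "continuous_on {u..v} c"
  shows "has_Bochner_int (lebesgue_on {u..v}) c (integral {u..v} c)"
proof -
  let ?M = "lebesgue_on {u..v}"
  define p where "p i x = u + of_int \<lfloor>(x - u) * Suc i\<rfloor> / Suc i" for i :: nat and x :: real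
  define s where "s i x = c (p i x)" for i x
  have p: "p i x \<in> {u..v}" "\<bar>x - p i x\<bar> \<le> 1 / Suc i" if "x \<in> {u..v}" for i x
  proof -
    have f0: "0 \<le> of_int \<lfloor>(x - u) * Suc i\<rfloor> / real (Suc i)" using that by simp
    have "of_int \<lfloor>(x - u) * Suc i\<rfloor> \<le> (x - u) * Suc i" by linarith
    then have f1: "of_int \<lfloor>(x - u) * Suc i\<rfloor> / real (Suc i) \<le> x - u"
      by (simp add: divide_le_eq)
    have "(x - u) * Suc i - 1 \<le> of_int \<lfloor>(x - u) * Suc i\<rfloor>" by linarith
    then have "((x - u) * Suc i - 1) / Suc i \<le> of_int \<lfloor>(x - u) * Suc i\<rfloor> / real (Suc i)"
      by (intro divide_right_mono) auto
    then have f2: "(x - u) - 1 / Suc i \<le> of_int \<lfloor>(x - u) * Suc i\<rfloor> / real (Suc i)"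
      by (simp add: diff_divide_distrib)
    show "p i x \<in> {u..v}" using f0 f1 that by (auto simp: p_def)
    show "\<bar>x - p i x\<bar> \<le> 1 / Suc i" using f0 f1 f2 by (auto simp: p_def)
  qed
  have sf: "simple_function ?M (s i)" for i
  proof -
    let ?k = "\<lambda>x::real. \<lfloor>(x - u) * Suc i\<rfloor>"
    have "?k ` {u..v} \<subseteq> {0..\<lfloor>(v - u) * Suc i\<rfloor>}"
      by (auto intro!: floor_mono mult_right_mono)
    then have fin: "finite (?k ` {u..v})" by (rule finite_subset) simp
    have "?k \<in> borel \<rightarrow>\<^sub>M count_space UNIV" by measurable
    then have "?k \<in> lebesgue \<rightarrow>\<^sub>M count_space UNIV"
      by (intro measurable_completion) simp
    then have "?k \<in> ?M \<rightarrow>\<^sub>M count_space UNIV" by (rule measurable_restrict_space1)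
    from measurable_sets[OF this] have "simple_function ?M ?k"
      using fin by (simp add: simple_function_def del: of_nat_Suc)
    from simple_function_compose1[OF this, of "\<lambda>k. c (u + of_int k / Suc i)"]
    show ?thesis by (simp add: s_def[abs_def] p_def)
  qed
  have fs: "emeasure ?M (space ?M) < \<infinity>"
    using emeasure_compact_finite[of "{u..v}"] by (simp add: emeasure_restrict_space)
  have sb: "Bochner_Integration.simple_bochner_integrable ?M (s i)" for i
  proof
    have "emeasure ?M {y \<in> space ?M. s i y \<noteq> 0} \<le> emeasure ?M (space ?M)"
      by (rule emeasure_space)
    then show "emeasure ?M {y \<in> space ?M. s i y \<noteq> 0} \<noteq> \<infinity>" using fs by auto
  qed (rule sf)
  have close: "\<forall>\<^sub>F i in sequentially. \<forall>x\<in>{u..v}. norm (c x - s i x) \<le> e" if e: "e > 0" for e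
  proof -
    have "uniformly_continuous_on {u..v} c"
      by (rule compact_uniformly_continuous[OF c]) simp
    then obtain d where d: "d > 0" "\<And>x x'. x \<in> {u..v} \<Longrightarrow> x' \<in> {u..v} \<Longrightarrow> dist x' x < d \<Longrightarrow> dist (c x') (c x) < e"
      using e unfolding uniformly_continuous_on_def by metis
    obtain N where N: "1 / real (Suc N) < d" using nat_approx_posE[OF d(1)] by auto
    show ?thesis
    proof (rule eventually_sequentiallyI[of N], rule ballI)
      fix i x assume i: "N \<le> i" and x: "x \<in> {u..v}"
      have "1 / real (Suc i) \<le> 1 / real (Suc N)" using i by (simp add: frac_le)
      then have "dist x (p i x) < d" using p(2)[OF x, of i] N by (simp add: dist_real_def)
      then have "dist (c x) (c (p i x)) < e" using d(2) p(1) x by blast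
      then show "norm (c x - s i x) \<le> e" by (simp add: s_def dist_norm)
    qed
  qed
  define B where "B = measure lebesgue {u..v}"
  have B: "emeasure ?M {u..v} = ennreal B" "B \<ge> 0"
    by (simp_all add: B_def emeasure_restrict_space emeasure_eq_measure2)
  have small: "\<exists>e'>0. e' * B < e" if "e > 0" for e :: real
    by (rule exI[of _ "e / (B + 1)"]) (use that B in \<open>auto simp: field_simps\<close>)
  have meas: "c \<in> borel_measurable ?M"
    by (rule continuous_imp_measurable_on_sets_lebesgue[OF c]) simp
  have "(\<lambda>i. \<integral>\<^sup>+w. ennreal (norm (c w - s i w)) \<partial>?M) \<longlonglongrightarrow> 0"
  proof (rule order_tendstoI)
    fix a :: ennreal assume "0 < a"
    then obtain e where e: "e > 0" "ennreal e < a"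
      by (metis dense ennreal_cases ennreal_less_zero_iff not_less_iff_gr_or_eq order_less_trans ennreal_top_neq_zero top.not_eq_extremum)
    obtain e' where e': "e' > 0" "e' * B < e" using small[OF e(1)] by auto
    from close[OF e'(1)] show "\<forall>\<^sub>F i in sequentially. (\<integral>\<^sup>+w. ennreal (norm (c w - s i w)) \<partial>?M) < a"
    proof eventually_elim
      case (elim i)
      have "(\<integral>\<^sup>+w. ennreal (norm (c w - s i w)) \<partial>?M) \<le> (\<integral>\<^sup>+w. ennreal e' \<partial>?M)"
        using elim by (intro nn_integral_mono) (auto intro: ennreal_leI)
      also have "\<dots> = ennreal (e' * B)" using e' B by (simp add: ennreal_mult)
      also have "\<dots> \<le> ennreal e" using e' by (intro ennreal_leI) simp
      also note e(2)
      finally show ?case .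
    qed
  qed simp
  moreover have "(\<lambda>i. Bochner_Integration.simple_bochner_integral ?M (s i)) \<longlonglongrightarrow> integral {u..v} c"
  proof (rule tendstoI)
    fix e :: real assume e: "e > 0"
    obtain e' where e': "e' > 0" "e' * B < e" using small[OF e(1)] by auto
    from close[OF e'(1)]
    show "\<forall>\<^sub>F i in sequentially. dist (Bochner_Integration.simple_bochner_integral ?M (s i)) (integral {u..v} c) < e"
    proof eventually_elim
      case (elim i)
      have "((\<lambda>x. s i x - c x) has_integral
          (Bochner_Integration.simple_bochner_integral ?M (s i) - integral {u..v} c)) {u..v}"
        by (intro has_integral_diff simple_bochner_integral_has_integral sf integrable_integral
            integrable_continuous_real c)
      then have "norm (Bochner_Integration.simple_bochner_integral ?M (s i) - integral {u..v} c)
          \<le> e' * measure lborel (cbox u v)"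
        using elim e' by (intro has_integral_bound[where f = "\<lambda>x. s i x - c x"])
          (auto simp: norm_minus_commute)
      also have "\<dots> = e' * B" by (simp add: B_def)
      also note e'(2)
      finally show ?case by (simp add: dist_norm)
    qed
  qed
  ultimately show ?thesis
    unfolding has_Bochner_int_def using meas sb by (intro conjI exI[of _ s]) auto
qed

section \<open>Means of continuous functions\<close>

lemma continuous_imp_L1_loc: "continuous_on UNIV f \<Longrightarrow> f \<in> L1_loc"
  unfolding L1_loc_def Bochner_integrable_def
  using has_Bochner_int_continuous continuous_on_subset by blast

text \<open>The mean integrates translates of \<open>f\<close> over a fixed interval; translation turns this into an
  integral of \<open>f\<close> itself, the form in which the equation can be integrated.\<close>

lemma has_Bochner_int_Mean:
  assumes f: "f \<in> L1_loc" and h: "h > 0"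
  shows "has_Bochner_int (lebesgue_on {t..t + h}) f (h *\<^sub>R Mean h f t)"
proof -
  have B: "has_Bochner_int (lebesgue_on {t + 0..t + h}) f (Bochner_int (lebesgue_on {t..t + h}) f)"
    using f by (simp add: L1_loc_def has_Bochner_int_Bochner_int)
  have "Bochner_int (lebesgue_on {0..h}) (\<lambda>s. f (t + s)) = Bochner_int (lebesgue_on {t..t + h}) f"
    by (rule Bochner_int_eqI[OF has_Bochner_int_translation[OF B]])
  then show ?thesis using B h by (simp add: Mean_def)
qed

lemma Mean_continuous:
  assumes "continuous_on UNIV f"
  shows "Mean h f t = (1 / h) *\<^sub>R integral {0..h} (\<lambda>s. f (t + s))"
proof -
  have "continuous_on {0..h} (\<lambda>s. f (t + s))"
    by (intro continuous_on_compose2[OF assms] continuous_intros) auto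
  then show ?thesis
    unfolding Mean_def by (simp add: Bochner_int_eqI[OF has_Bochner_int_continuous])
qed

lemma Mean_of_derivative:
  assumes f: "continuous_on UNIV f" and h: "h > 0"
    and F: "\<And>x. (F has_vector_derivative f x) (at x)"
  shows "Mean h f t = (1 / h) *\<^sub>R (F (t + h) - F t)"
proof -
  have "((\<lambda>s. F (t + s)) has_vector_derivative f (t + s)) (at s within {0..h})" for s
  proof (rule has_vector_derivative_at_within)
    have "((\<lambda>s. t + s) has_vector_derivative 1) (at s)"
      by (auto intro!: derivative_eq_intros)
    from vector_diff_chain_at[OF this F]
    show "((\<lambda>s. F (t + s)) has_vector_derivative f (t + s)) (at s)" by (simp add: o_def)
  qed
  then have "((\<lambda>s. f (t + s)) has_integral (F (t + h) - F (t + 0))) {0..h}"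
    using h by (intro fundamental_theorem_of_calculus) auto
  then show ?thesis by (simp add: Mean_continuous[OF f] integral_unique)
qed

lemma integrable_shifted:
  fixes f :: "real \<Rightarrow> 'b::banach"
  assumes "continuous_on UNIV f"
  shows "(\<lambda>s. f (t + s)) integrable_on {u..v}"
  by (intro integrable_continuous_real continuous_on_compose2[OF assms] continuous_intros) auto

lemma continuous_Mean:
  assumes "continuous_on UNIV f"
  shows "continuous_on UNIV (Mean h f)"
proof -
  have "continuous_on UNIV (\<lambda>t. integral (cbox 0 h) (\<lambda>s. f (t + s)))"
    by (rule integral_continuous_on_param)
       (auto simp: case_prod_unfold intro!: continuous_on_compose2[OF assms] continuous_intros)
  then have "continuous_on UNIV (\<lambda>t. (1 / h) *\<^sub>R integral {0..h} (\<lambda>s. f (t + s)))"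
    by (intro continuous_intros) simp
  then show ?thesis by (simp add: Mean_continuous[OF assms, abs_def])
qed

lemma Mean_add:
  assumes "continuous_on UNIV f" "continuous_on UNIV g"
  shows "Mean h (\<lambda>x. f x + g x) = (\<lambda>t. Mean h f t + Mean h g t)"
proof
  fix t
  have "continuous_on UNIV (\<lambda>x. f x + g x)" by (intro continuous_intros assms)
  then show "Mean h (\<lambda>x. f x + g x) t = Mean h f t + Mean h g t"
    by (simp add: Mean_continuous assms integral_add integrable_shifted scaleR_add_right)
qed

lemma Mean_bounded_linear:
  assumes "continuous_on UNIV f" and L: "bounded_linear L"
  shows "Mean h (\<lambda>x. L (f x)) = (\<lambda>t. L (Mean h f t))"
proof
  fix t
  interpret L: bounded_linear L by fact
  have "continuous_on UNIV (\<lambda>x. L (f x))" by (intro L.continuous_on assms)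
  then show "Mean h (\<lambda>x. L (f x)) t = L (Mean h f t)"
    using integral_linear[OF integrable_shifted[OF assms(1), where t = t and u = 0 and v = h] L]
    by (simp add: Mean_continuous assms L.scaleR o_def)
qed

lemma Mean_shift: "Mean h (\<lambda>x. f (x + c)) = (\<lambda>t. Mean h f (t + c))"
  by (rule ext) (simp add: Mean_def add_ac)

lemma Mean_diff_shift:
  assumes f: "continuous_on UNIV f"
  shows "Mean h (\<lambda>x. f (x + a) - f (x + b)) = (\<lambda>t. Mean h f (t + a) - Mean h f (t + b))"
proof -
  have c: "continuous_on UNIV (\<lambda>x. f (x + a))" "continuous_on UNIV (\<lambda>x. - f (x + b))"
    by (auto intro!: continuous_intros continuous_on_compose2[OF f])
  have "continuous_on UNIV (\<lambda>x. f (x + b))"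
    by (auto intro!: continuous_intros continuous_on_compose2[OF f])
  from Mean_bounded_linear[OF this bounded_linear_minus[OF bounded_linear_ident]] Mean_add[OF c]
  show ?thesis by (simp add: Mean_shift)
qed

lemma norm_Mean_diff_le:
  assumes f: "continuous_on UNIV f" and h: "h > 0"
    and le: "\<And>s. s \<in> {0..h} \<Longrightarrow> norm (f (t + s) - c) \<le> e"
  shows "norm (Mean h f t - c) \<le> e"
proof -
  have le': "norm (integral {0..h} (\<lambda>s. f (t + s) - c)) \<le> e * (h - 0)"
    using h le by (intro integral_bound continuous_intros continuous_on_compose2[OF f]) auto
  have "integral {0..h} (\<lambda>s. f (t + s) - c) = integral {0..h} (\<lambda>s. f (t + s)) - integral {0..h} (\<lambda>s. c)"
    by (intro integral_diff integrable_shifted[OF f] integrable_continuous_real continuous_intros)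
  then have "integral {0..h} (\<lambda>s. f (t + s) - c) = h *\<^sub>R (Mean h f t - c)"
    using h by (simp add: Mean_continuous[OF f] scaleR_diff_right)
  then show ?thesis using h le' by (simp add: mult.commute)
qed

section \<open>Uniform continuity and iterated means\<close>

lemma C_u_D:
  assumes "f \<in> C_u" "e > 0"
  obtains d where "d > 0" "\<And>x x'. \<bar>x - x'\<bar> < d \<Longrightarrow> norm (f x - f x') < e"
  using assms unfolding C_u_def uniformly_continuous_on_def dist_norm by (fastforce simp: real_norm_def)

lemma C_u_I:
  assumes "\<And>e. e > 0 \<Longrightarrow> \<exists>d>0. \<forall>x x'. \<bar>x - x'\<bar> < d \<longrightarrow> norm (f x - f x') \<le> e"
  shows "f \<in> C_u"
  unfolding C_u_def mem_Collect_eq uniformly_continuous_on_def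
proof (intro allI impI)
  fix e :: real assume "e > 0"
  then obtain d where "d > 0" "\<And>x x'. \<bar>x - x'\<bar> < d \<Longrightarrow> norm (f x - f x') \<le> e / 2"
    using assms[of "e / 2"] by auto
  then show "\<exists>d>0. \<forall>x\<in>UNIV. \<forall>x'\<in>UNIV. dist x' x < d \<longrightarrow> dist (f x') (f x) < e"
    using \<open>e > 0\<close> by (intro exI[of _ d]) (fastforce simp: dist_norm)
qed

lemma C_u_continuous: "f \<in> C_u \<Longrightarrow> continuous_on UNIV f"
  by (simp add: C_u_def uniformly_continuous_imp_continuous)

lemma Mean_C_u:
  assumes f: "f \<in> C_u" and h: "h > 0"
  shows "Mean h f \<in> C_u"
proof (rule C_u_I)
  note c = C_u_continuous[OF f]
  fix e :: real assume "e > 0"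
  with f obtain d where d: "d > 0" "\<And>x x'. \<bar>x - x'\<bar> < d \<Longrightarrow> norm (f x - f x') < e"
    by (rule C_u_D) blast
  have "norm (Mean h f x - Mean h f x') \<le> e" if "\<bar>x - x'\<bar> < d" for x x'
  proof -
    have c': "continuous_on UNIV (\<lambda>s. f (s + x) - f (s + x'))"
      by (auto intro!: continuous_intros continuous_on_compose2[OF c])
    have "norm (Mean h (\<lambda>s. f (s + x) - f (s + x')) 0 - 0) \<le> e"
      using d(2) that by (intro norm_Mean_diff_le[OF c' h]) (auto intro!: less_imp_le)
    then show ?thesis by (simp add: Mean_diff_shift[OF c])
  qed
  then show "\<exists>d>0. \<forall>x x'. \<bar>x - x'\<bar> < d \<longrightarrow> norm (Mean h f x - Mean h f x') \<le> e"
    using d(1) by blast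
qed

text \<open>For continuous functions the requirement of local integrability in the iterated classes is
  automatic, and membership is a condition on means only.\<close>

lemma MM_pow_0_continuous: "continuous_on UNIV f \<Longrightarrow> f \<in> MM_pow 0 A \<longleftrightarrow> f \<in> A"
  by (simp add: continuous_imp_L1_loc)

lemma MM_pow_Suc_continuous:
  "continuous_on UNIV f \<Longrightarrow> f \<in> MM_pow (Suc p) A \<longleftrightarrow> (\<forall>h>0. Mean h f \<in> MM_pow p A)"
  by (simp add: MM_def continuous_imp_L1_loc)

lemmas MM_pow_continuous = MM_pow_0_continuous MM_pow_Suc_continuous

declare MM_pow.simps [simp del]

lemma MM_pow_C_u_add:
  assumes "continuous_on UNIV f" "continuous_on UNIV g" "f \<in> MM_pow p C_u" "g \<in> MM_pow p C_u"
  shows "(\<lambda>x. f x + g x) \<in> MM_pow p C_u"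
  using assms
proof (induction p arbitrary: f g)
  case 0
  then have "(\<lambda>x. f x + g x) \<in> C_u"
    by (auto simp: C_u_def MM_pow_continuous intro: uniformly_continuous_on_add)
  then show ?case by (simp add: MM_pow_continuous C_u_continuous)
next
  case (Suc p)
  then show ?case
    by (auto simp: MM_pow_continuous continuous_on_add Mean_add continuous_Mean)
qed

lemma MM_pow_C_u_bounded_linear:
  assumes L: "bounded_linear L" and "continuous_on UNIV f" "f \<in> MM_pow p C_u"
  shows "(\<lambda>x. L (f x)) \<in> MM_pow p C_u"
  using assms(2,3)
proof (induction p arbitrary: f)
  case 0
  then have "(\<lambda>x. L (f x)) \<in> C_u"
    by (auto simp: C_u_def MM_pow_continuous intro: bounded_linear.uniformly_continuous_on[OF L])
  then show ?case by (simp add: MM_pow_continuous C_u_continuous)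
next
  case (Suc p)
  then show ?case
    by (auto simp: MM_pow_continuous bounded_linear.continuous_on[OF L] Mean_bounded_linear[OF _ L] continuous_Mean)
qed

lemma MM_pow_C_u_shift:
  assumes "continuous_on UNIV f" "f \<in> MM_pow p C_u"
  shows "(\<lambda>x. f (x + c)) \<in> MM_pow p C_u"
  using assms
proof (induction p arbitrary: f)
  case 0
  then have "f \<in> C_u" by (simp add: MM_pow_continuous)
  have "(\<lambda>x. f (x + c)) \<in> C_u"
  proof (rule C_u_I)
    fix e :: real assume "e > 0"
    with \<open>f \<in> C_u\<close> obtain d where "d > 0" "\<And>x x'. \<bar>x - x'\<bar> < d \<Longrightarrow> norm (f x - f x') < e"
      by (rule C_u_D) blast
    then show "\<exists>d>0. \<forall>x x'. \<bar>x - x'\<bar> < d \<longrightarrow> norm (f (x + c) - f (x' + c)) \<le> e"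
      by (intro exI[of _ d]) (auto intro!: less_imp_le)
  qed
  then show ?case by (simp add: MM_pow_continuous C_u_continuous)
next
  case (Suc p)
  have "continuous_on UNIV (\<lambda>x. f (x + c))"
    by (auto intro!: continuous_intros continuous_on_compose2[OF Suc.prems(1)])
  with Suc show ?case
    by (auto simp: MM_pow_continuous Mean_shift continuous_Mean)
qed

lemma MM_pow_C_u_diff:
  assumes "continuous_on UNIV f" "continuous_on UNIV g" "f \<in> MM_pow p C_u" "g \<in> MM_pow p C_u"
  shows "(\<lambda>x. f x - g x) \<in> MM_pow p C_u"
  using MM_pow_C_u_add[of f "\<lambda>x. - g x" p] assms
    MM_pow_C_u_bounded_linear[OF bounded_linear_minus[OF bounded_linear_ident], of g p]
  by (simp add: continuous_on_minus)

lemma MM_pow_C_u_Suc: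
  assumes "continuous_on UNIV f" "f \<in> MM_pow p C_u"
  shows "f \<in> MM_pow (Suc p) C_u"
  using assms
proof (induction p arbitrary: f)
  case 0
  then show ?case by (auto simp: MM_pow_continuous continuous_Mean Mean_C_u)
next
  case (Suc p)
  then show ?case
    by (metis MM_pow_Suc_continuous continuous_Mean)
qed

lemma MM_pow_C_u_mono:
  assumes "p \<le> q" "continuous_on UNIV f" "f \<in> MM_pow p C_u"
  shows "f \<in> MM_pow q C_u"
  using assms by (induction rule: dec_induct) (auto intro: MM_pow_C_u_Suc)

lemma MM_pow_C_u_sum:
  assumes "\<And>i. i \<in> I \<Longrightarrow> continuous_on UNIV (f i)" "\<And>i. i \<in> I \<Longrightarrow> f i \<in> MM_pow p C_u"
  shows "(\<lambda>x. \<Sum>i\<in>I. f i x) \<in> MM_pow p C_u"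
proof -
  have "(\<lambda>_. 0) \<in> MM_pow 0 C_u"
    by (simp add: MM_pow_continuous C_u_def uniformly_continuous_on_const)
  then have zero: "(\<lambda>_. 0) \<in> MM_pow p C_u"
    by (rule MM_pow_C_u_mono[rotated 2]) auto
  show ?thesis
    using assms
    by (induction I rule: infinite_finite_induct)
       (auto simp: zero intro!: MM_pow_C_u_add continuous_on_sum)
qed

text \<open>Let \<open>x\<^sub>n - y\<^sub>n \<longlonglongrightarrow> 0\<close> and \<open>\<phi>\<^sub>n(s) = F(s + x\<^sub>n) - F(s + y\<^sub>n)\<close>. Uniform continuity of the
  differences says that \<open>\<phi>\<^sub>n(s) - \<phi>\<^sub>n(0) \<longlonglongrightarrow> 0\<close> for each \<open>s\<close>. By Baire's theorem the difference is
  at most \<open>e / 2\<close> for all large \<open>n\<close> uniformly in \<open>s\<close> over some interval, so \<open>\<phi>\<^sub>n(0)\<close> is within \<open>e / 2\<close> of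
  the mean of \<open>\<phi>\<^sub>n\<close> over that interval. This mean tends to \<open>0\<close> because the means of \<open>F\<close> are
  uniformly continuous.\<close>

lemma C_u_of_differences:
  assumes F: "continuous_on UNIV F"
    and means: "\<And>h. h > 0 \<Longrightarrow> Mean h F \<in> C_u"
    and diffs: "\<And>h. h > 0 \<Longrightarrow> (\<lambda>t. F (t + h) - F t) \<in> C_u"
  shows "F \<in> C_u"
  unfolding C_u_def mem_Collect_eq uniformly_continuous_on_sequentially
proof (intro allI impI)
  fix x y :: "nat \<Rightarrow> real"
  assume "(\<forall>n. x n \<in> UNIV) \<and> (\<forall>n. y n \<in> UNIV) \<and> (\<lambda>n. dist (x n) (y n)) \<longlonglongrightarrow> 0"
  then have xy: "(\<lambda>n. dist (x n) (y n)) \<longlonglongrightarrow> 0" by simp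
  have seq: "(\<lambda>n. norm (g (x n + s) - g (y n + s))) \<longlonglongrightarrow> 0" if "g \<in> C_u" for g :: "real \<Rightarrow> 'a" and s
  proof -
    have "(\<lambda>n. dist (g (x n + s)) (g (y n + s))) \<longlonglongrightarrow> 0"
      using that[unfolded C_u_def mem_Collect_eq uniformly_continuous_on_sequentially,
          rule_format, of "\<lambda>n. x n + s" "\<lambda>n. y n + s"] xy
      by simp
    then show ?thesis by (simp add: dist_norm)
  qed
  define \<phi> where "\<phi> n s = F (s + x n) - F (s + y n)" for n s
  have c\<phi>: "continuous_on UNIV (\<phi> n)" for n
    unfolding \<phi>_def by (auto intro!: continuous_intros continuous_on_compose2[OF F])
  \<comment> \<open>for negative \<open>s\<close> the difference with step \<open>- s\<close> is evaluated at the points shifted by \<open>s\<close>\<close>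
  have lim: "(\<lambda>n. norm (\<phi> n s - \<phi> n 0)) \<longlonglongrightarrow> 0" for s
  proof (cases s "0 :: real" rule: linorder_cases)
    case less
    then show ?thesis
      using seq[OF diffs[of "- s"], of s] by (simp add: \<phi>_def algebra_simps norm_minus_commute)
  next
    case greater
    then show ?thesis
      using seq[OF diffs[of s], of 0] by (simp add: \<phi>_def algebra_simps)
  qed simp
  have "\<forall>\<^sub>F n in sequentially. norm (\<phi> n 0) < e" if "e > 0" for e
  proof -
    define E where "E N = {s. \<forall>n\<ge>N. norm (\<phi> n s - \<phi> n 0) \<le> e / 2}" for N
    have closed: "closed (E N)" for N
    proof -
      have "E N = (\<Inter>n\<in>{N..}. {s. norm (\<phi> n s - \<phi> n 0) \<le> e / 2})"
        by (auto simp: E_def)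
      also have "closed \<dots>"
        by (intro closed_INT ballI closed_Collect_le continuous_intros c\<phi>)
      finally show ?thesis .
    qed
    have cover: "\<exists>N. s \<in> E N" for s
    proof -
      have "\<forall>\<^sub>F n in sequentially. norm (\<phi> n s - \<phi> n 0) < e / 2"
        using order_tendstoD(2)[OF lim[of s], of "e / 2"] \<open>e > 0\<close> by simp
      then show ?thesis unfolding E_def eventually_sequentially by (auto intro: less_imp_le)
    qed
    \<comment> \<open>closed sets with empty interior cannot cover the line\<close>
    have "\<exists>N. interior (E N) \<noteq> {}"
    proof (rule ccontr)
      assume "\<not> (\<exists>N. interior (E N) \<noteq> {})"
      then have "UNIV \<subseteq> closure (\<Inter>(range (\<lambda>N. - E N)))"
        using closed by (intro Baire) (auto simp: open_Compl closure_complement)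
      moreover have "\<Inter>(range (\<lambda>N. - E N)) = {}" using cover by auto
      ultimately show False by simp
    qed
    then obtain N z where "z \<in> interior (E N)" by blast
    then obtain r where r: "r > 0" "cball z r \<subseteq> E N" by (meson mem_interior_cball)
    have close: "norm (Mean r (\<phi> n) z - \<phi> n 0) \<le> e / 2" if "n \<ge> N" for n
    proof (rule norm_Mean_diff_le[OF c\<phi> r(1)])
      fix s assume "s \<in> {0..r}"
      then have "z + s \<in> E N" using r(2) by (auto simp: dist_real_def subset_iff)
      then show "norm (\<phi> n (z + s) - \<phi> n 0) \<le> e / 2" using that by (auto simp: E_def)
    qed
    have "(\<lambda>n. norm (Mean r F (x n + z) - Mean r F (y n + z))) \<longlonglongrightarrow> 0"
      by (rule seq[OF means[OF r(1)]])
    then have "\<forall>\<^sub>F n in sequentially. norm (Mean r (\<phi> n) z) < e / 2"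
      using order_tendstoD(2)[of _ 0 sequentially "e / 2"] \<open>e > 0\<close>
      by (simp add: \<phi>_def[abs_def] Mean_diff_shift[OF F] add.commute)
    then show ?thesis
      using eventually_ge_at_top[of N]
    proof eventually_elim
      case (elim n)
      have "norm (\<phi> n 0) \<le> norm (Mean r (\<phi> n) z) + norm (Mean r (\<phi> n) z - \<phi> n 0)"
        by (metis norm_triangle_sub norm_minus_commute)
      then show ?case using elim close by fastforce
    qed
  qed
  then have "(\<lambda>n. norm (\<phi> n 0)) \<longlonglongrightarrow> 0"
    by (intro order_tendstoI) (auto intro!: always_eventually intro: less_le_trans[OF _ norm_ge_zero])
  then show "(\<lambda>n. dist (F (x n)) (F (y n))) \<longlonglongrightarrow> 0"
    by (simp add: \<phi>_def dist_norm)
qed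

text \<open>Means commute with translations, so the hypotheses for \<open>F\<close> at exponent \<open>p + 1\<close> are those for
  every \<open>Mean k F\<close> at exponent \<open>p\<close>.\<close>

lemma MM_pow_C_u_of_differences:
  assumes "continuous_on UNIV F" "F \<in> MM_pow (Suc p) C_u"
    and "\<And>h. h > 0 \<Longrightarrow> (\<lambda>t. F (t + h) - F t) \<in> MM_pow p C_u"
  shows "F \<in> MM_pow p C_u"
  using assms
proof (induction p arbitrary: F)
  case 0
  have c: "continuous_on UNIV (\<lambda>t. F (t + h) - F t)" for h
    by (auto intro!: continuous_intros continuous_on_compose2[OF 0(1)])
  have "F \<in> C_u"
  proof (rule C_u_of_differences[OF 0(1)])
    fix h :: real assume h: "h > 0"
    show "Mean h F \<in> C_u"
      using 0(2) h by (simp add: MM_pow_Suc_continuous[OF 0(1)] MM_pow_0_continuous continuous_Mean[OF 0(1)])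
    show "(\<lambda>t. F (t + h) - F t) \<in> C_u"
      using 0(3)[OF h] by (simp only: MM_pow_0_continuous[OF c])
  qed
  then show ?case by (simp add: MM_pow_0_continuous[OF 0(1)])
next
  case (Suc p)
  have "Mean k F \<in> MM_pow p C_u" if k: "k > 0" for k
  proof (rule Suc.IH)
    show "continuous_on UNIV (Mean k F)" by (rule continuous_Mean[OF Suc.prems(1)])
    show "Mean k F \<in> MM_pow (Suc p) C_u"
      using Suc.prems(1,2) k by (simp add: MM_pow_Suc_continuous[of F])
    fix h :: real assume h: "h > 0"
    have c: "continuous_on UNIV (\<lambda>t. F (t + h) - F t)"
      by (auto intro!: continuous_intros continuous_on_compose2[OF Suc.prems(1)])
    have "Mean k (\<lambda>t. F (t + h) - F t) \<in> MM_pow p C_u"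
      using Suc.prems(3)[OF h] k by (simp add: MM_pow_Suc_continuous[OF c])
    then show "(\<lambda>t. Mean k F (t + h) - Mean k F t) \<in> MM_pow p C_u"
      using Mean_diff_shift[OF Suc.prems(1), of k h 0] by simp
  qed
  then show ?case by (simp add: MM_pow_Suc_continuous[OF Suc.prems(1)])
qed

section \<open>Recurrent functions\<close>

lemma REC_continuous: "f \<in> REC \<Longrightarrow> continuous_on UNIV f"
  by (simp add: REC_def)

lemma relatively_dense_mono: "relatively_dense E \<Longrightarrow> E \<subseteq> E' \<Longrightarrow> relatively_dense E'"
  unfolding relatively_dense_def set_eq_iff mem_Collect_eq by (meson UNIV_I subsetD)

lemma REC_relatively_dense:
  "f \<in> REC \<Longrightarrow> compact K \<Longrightarrow> \<epsilon> > 0 \<Longrightarrow> relatively_dense (almost_periods f \<epsilon> K)"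
  by (simp add: REC_def)

lemma REC_I:
  assumes "continuous_on UNIV f"
    and "\<And>K \<epsilon>. compact K \<Longrightarrow> \<epsilon> > 0 \<Longrightarrow> relatively_dense (almost_periods f \<epsilon> K)"
  shows "f \<in> REC"
  using assms by (simp add: REC_def)

lemma REC_uniform_limit:
  assumes "continuous_on UNIV f" and lim: "\<And>e. e > 0 \<Longrightarrow> \<exists>g\<in>REC. \<forall>t. norm (g t - f t) \<le> e"
  shows "f \<in> REC"
proof (rule REC_I[OF assms(1)])
  fix K :: "real set" and \<epsilon> :: real assume K: "compact K" and \<epsilon>: "\<epsilon> > 0"
  then obtain g where g: "g \<in> REC" "\<And>t. norm (g t - f t) \<le> \<epsilon> / 3"
    using lim[of "\<epsilon> / 3"] by auto
  have "norm (f (t + \<tau>) - f t) \<le> \<epsilon>" if "norm (g (t + \<tau>) - g t) \<le> \<epsilon> / 3" for t \<tau>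
  proof -
    have "f (t + \<tau>) - f t = (g (t + \<tau>) - g t) + (g t - f t) - (g (t + \<tau>) - f (t + \<tau>))" by simp
    then have "norm (f (t + \<tau>) - f t)
        \<le> norm (g (t + \<tau>) - g t) + norm (g t - f t) + norm (g (t + \<tau>) - f (t + \<tau>))"
      by (smt (verit) norm_triangle_ineq norm_triangle_ineq4)
    then show ?thesis using that g(2)[of t] g(2)[of "t + \<tau>"] by linarith
  qed
  then have "almost_periods g (\<epsilon> / 3) K \<subseteq> almost_periods f \<epsilon> K"
    by (auto simp: almost_periods_def)
  then show "relatively_dense (almost_periods f \<epsilon> K)"
    using REC_relatively_dense[OF g(1) K, of "\<epsilon> / 3"] \<epsilon> relatively_dense_mono by auto
qed

text \<open>An approximate period of \<open>f\<close> on \<open>K\<close> and on \<open>K + h\<close> at once is one of the difference on \<open>K\<close>. The common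
  approximate periods of two unrelated recurrent functions need not be relatively dense.\<close>

lemma REC_difference:
  assumes f: "f \<in> REC"
  shows "(\<lambda>t. c *\<^sub>R (f (t + h) - f t)) \<in> REC"
proof (rule REC_I)
  show "continuous_on UNIV (\<lambda>t. c *\<^sub>R (f (t + h) - f t))"
    by (auto intro!: continuous_intros continuous_on_compose2[OF REC_continuous[OF f]])
  fix K :: "real set" and \<epsilon> :: real assume K: "compact K" and \<epsilon>: "\<epsilon> > 0"
  define \<delta> where "\<delta> = \<epsilon> / (2 * (\<bar>c\<bar> + 1))"
  have \<delta>: "\<delta> > 0" "\<bar>c\<bar> * (2 * \<delta>) \<le> \<epsilon>" using \<epsilon> by (auto simp: \<delta>_def field_simps)
  have "almost_periods f \<delta> (K \<union> (\<lambda>t. h + t) ` K) \<subseteq> almost_periods (\<lambda>t. c *\<^sub>R (f (t + h) - f t)) \<epsilon> K"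
  proof
    fix \<tau> assume \<tau>: "\<tau> \<in> almost_periods f \<delta> (K \<union> (\<lambda>t. h + t) ` K)"
    have "norm (c *\<^sub>R (f (t + \<tau> + h) - f (t + \<tau>)) - c *\<^sub>R (f (t + h) - f t)) \<le> \<epsilon>" if "t \<in> K" for t
    proof -
      have "norm (f (t + \<tau>) - f t) \<le> \<delta>" "norm (f (t + h + \<tau>) - f (t + h)) \<le> \<delta>"
        using \<tau> that by (auto simp: almost_periods_def add.commute)
      then have "norm ((f (t + h + \<tau>) - f (t + h)) - (f (t + \<tau>) - f t)) \<le> 2 * \<delta>"
        by (smt (verit) norm_triangle_ineq4)
      then have "\<bar>c\<bar> * norm ((f (t + h + \<tau>) - f (t + h)) - (f (t + \<tau>) - f t)) \<le> \<bar>c\<bar> * (2 * \<delta>)"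
        by (intro mult_left_mono) auto
      also note \<delta>(2)
      finally have "norm (c *\<^sub>R ((f (t + h + \<tau>) - f (t + h)) - (f (t + \<tau>) - f t))) \<le> \<epsilon>" by simp
      then show ?thesis by (simp add: algebra_simps)
    qed
    then show "\<tau> \<in> almost_periods (\<lambda>t. c *\<^sub>R (f (t + h) - f t)) \<epsilon> K"
      by (auto simp: almost_periods_def)
  qed
  moreover have "compact (K \<union> (\<lambda>t. h + t) ` K)"
    by (intro compact_Un K compact_translation)
  ultimately show "relatively_dense (almost_periods (\<lambda>t. c *\<^sub>R (f (t + h) - f t)) \<epsilon> K)"
    using REC_relatively_dense[OF f _ \<delta>(1)] relatively_dense_mono by blast
qed

lemma REC_of_means:
  assumes f: "f \<in> C_u" and means: "\<And>h. h > 0 \<Longrightarrow> Mean h f \<in> REC"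
  shows "f \<in> REC"
proof (rule REC_uniform_limit[OF C_u_continuous[OF f]])
  fix e :: real assume "e > 0"
  with f obtain d where d: "d > 0" "\<And>x x'. \<bar>x - x'\<bar> < d \<Longrightarrow> norm (f x - f x') < e"
    by (rule C_u_D) blast
  have "norm (Mean (d / 2) f t - f t) \<le> e" for t
    using d by (intro norm_Mean_diff_le C_u_continuous f) (auto intro!: less_imp_le)
  then show "\<exists>g\<in>REC. \<forall>t. norm (g t - f t) \<le> e"
    using means[of "d / 2"] d(1) by auto
qed

text \<open>The innermost step of the iteration is undone first: the means of \<open>f\<close> are again uniformly
  continuous, hence recurrent by induction, and they approximate \<open>f\<close> uniformly.\<close>

lemma REC_of_MM_pow:
  assumes "f \<in> C_u" "f \<in> MM_pow p REC"
  shows "f \<in> REC"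
  using assms
proof (induction p arbitrary: f)
  case 0
  then show ?case by (simp add: MM_pow_continuous C_u_continuous)
next
  case (Suc p)
  have "Mean h f \<in> REC" if "h > 0" for h
    using Suc that by (intro Suc.IH Mean_C_u) (simp_all add: MM_pow_Suc_continuous C_u_continuous)
  then show ?case by (rule REC_of_means[OF Suc.prems(1)])
qed

section \<open>Matrices acting on vectors over a complex Banach space\<close>

lemma scaleC_zero_right: "c *\<^sub>C (0::'x::complex_banach) = 0"
  using scaleC_add_right[of c "0::'x" 0] by simp

lemma scaleC_sum_right: "c *\<^sub>C (\<Sum>i\<in>I. v i) = (\<Sum>i\<in>I. c *\<^sub>C v i)"
  by (induction I rule: infinite_finite_induct) (auto simp: scaleC_zero_right scaleC_add_right)

lemma scaleC_zero_left: "0 *\<^sub>C (x::'x::complex_banach) = 0"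
  using scaleC_add_left[of 0 0 x] by simp

lemma scaleC_sum_left: "(\<Sum>i\<in>I. c i) *\<^sub>C v = (\<Sum>i\<in>I. c i *\<^sub>C v)"
  by (induction I rule: infinite_finite_induct) (auto simp: scaleC_zero_left scaleC_add_left)

lemma scaleC_scaleR: "c *\<^sub>C b *\<^sub>R x = b *\<^sub>R c *\<^sub>C x"
  by (simp add: scaleC_of_real[symmetric] scaleC_scaleC mult.commute)

lemma bounded_linear_mat_act: "bounded_linear ((*\<^sub>M) A :: 'x::complex_banach ^ 'r \<Rightarrow> 'x ^ 'r)"
proof (rule bounded_linear_intro[where K = "\<Sum>p\<in>UNIV. \<Sum>q\<in>UNIV. cmod (A $ p $ q)"])
  fix v w :: "'x ^ 'r" and b :: real
  show "A *\<^sub>M (v + w) = A *\<^sub>M v + A *\<^sub>M w"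
    by (simp add: mat_act_def vec_eq_iff scaleC_add_right sum.distrib)
  show "A *\<^sub>M b *\<^sub>R v = b *\<^sub>R A *\<^sub>M v"
    by (simp add: mat_act_def vec_eq_iff scaleC_scaleR scaleR_sum_right)
  have "norm (A *\<^sub>M v) \<le> (\<Sum>p\<in>UNIV. norm ((A *\<^sub>M v) $ p))"
    unfolding norm_vec_def by (rule L2_set_le_sum) simp
  also have "\<dots> \<le> (\<Sum>p\<in>UNIV. \<Sum>q\<in>UNIV. cmod (A $ p $ q) * norm v)"
  proof (rule sum_mono)
    fix p
    have "norm ((A *\<^sub>M v) $ p) \<le> (\<Sum>q\<in>UNIV. norm (A $ p $ q *\<^sub>C v $ q))"
      by (simp add: mat_act_def norm_sum)
    also have "\<dots> \<le> (\<Sum>q\<in>UNIV. cmod (A $ p $ q) * norm v)"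
      by (intro sum_mono) (simp add: norm_scaleC mult_left_mono Finite_Cartesian_Product.norm_nth_le)
    finally show "norm ((A *\<^sub>M v) $ p) \<le> (\<Sum>q\<in>UNIV. cmod (A $ p $ q) * norm v)" .
  qed
  finally show "norm (A *\<^sub>M v) \<le> norm v * (\<Sum>p\<in>UNIV. \<Sum>q\<in>UNIV. cmod (A $ p $ q))"
    by (simp add: sum_distrib_left sum_distrib_right mult.commute)
qed

lemma mat_act_mult: "A *\<^sub>M B *\<^sub>M v = (A ** B) *\<^sub>M v"
proof -
  have "(\<Sum>q\<in>UNIV. \<Sum>k\<in>UNIV. (A $ p $ q * B $ q $ k) *\<^sub>C v $ k)
      = (\<Sum>k\<in>UNIV. \<Sum>q\<in>UNIV. (A $ p $ q * B $ q $ k) *\<^sub>C v $ k)" for p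
    by (rule sum.swap)
  then show ?thesis
    by (simp add: mat_act_def matrix_matrix_mult_def vec_eq_iff scaleC_sum_right scaleC_sum_left scaleC_scaleC)
qed

lemma mat_act_1: "mat 1 *\<^sub>M v = v"
proof -
  have "(if p = q then 1 else 0) *\<^sub>C v $ q = (if p = q then v $ q else 0)" for p q
    using scaleC_of_real[of 1 "v $ q"] by (simp add: scaleC_zero_left)
  then show ?thesis by (simp add: mat_act_def mat_def vec_eq_iff)
qed


lemma mat_act_0: "0 *\<^sub>M v = 0"
  by (simp add: mat_act_def vec_eq_iff scaleC_zero_left)

lemma mat_act_left_inverse:
  assumes "det A \<noteq> 0"
  obtains B where "\<And>v. B *\<^sub>M A *\<^sub>M v = v"
proof -
  obtain B where "B ** A = mat 1"
    using assms by (auto simp: invertible_det_nz[symmetric] invertible_def)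
  then show ?thesis by (intro that[of B]) (simp add: mat_act_mult mat_act_1)
qed

section \<open>The differential-difference equation\<close>

lemma W_loc_derivs_continuous: "W_loc_derivs n y D \<Longrightarrow> k < n \<Longrightarrow> continuous_on UNIV (D k)"
  by (simp add: W_loc_derivs_def)

text \<open>The fundamental theorem of calculus in both of its guises: below the top order the derivative is
  classical and continuous, whereas the top derivative is only a Bochner density.\<close>

lemma W_loc_derivs_Mean:
  assumes W: "W_loc_derivs n y D" and k: "k < n" and h: "h > 0"
  shows "Mean h (D (Suc k)) x = (1 / h) *\<^sub>R (D k (x + h) - D k x)"
proof (cases "Suc k < n")
  case True
  with W show ?thesis
    by (intro Mean_of_derivative h) (auto simp: W_loc_derivs_def)
next
  case False
  then have n: "n = Suc k" using k by simp
  have "D k (x + h) - D k x = Bochner_int (lebesgue_on {x..x + h}) (D n)"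
    using W h by (auto simp: W_loc_derivs_def n)
  also have "\<dots> = h *\<^sub>R Mean h (D n) x"
    using W by (intro Bochner_int_eqI has_Bochner_int_Mean h) (simp add: W_loc_derivs_def)
  finally show ?thesis using h by (simp add: n)
qed

lemma W_loc_derivs_MM_pow:
  assumes W: "W_loc_derivs n y D" and y: "y \<in> MM_pow s C_u" and k: "k < n"
  shows "D k \<in> MM_pow (s + k) C_u"
  using k
proof (induction k)
  case 0
  with W y show ?case by (simp add: W_loc_derivs_def)
next
  case (Suc k)
  note c = W_loc_derivs_continuous[OF W]
  have "Mean h (D (Suc k)) \<in> MM_pow (s + k) C_u" if h: "h > 0" for h
  proof -
    have ck: "continuous_on UNIV (D k)" using c Suc.prems by simp
    then have ch: "continuous_on UNIV (\<lambda>x. D k (x + h))"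
      by (auto intro!: continuous_intros continuous_on_compose2[OF ck])
    have "(\<lambda>x. (1 / h) *\<^sub>R (D k (x + h) - D k x)) \<in> MM_pow (s + k) C_u"
      using Suc by (intro MM_pow_C_u_bounded_linear[OF bounded_linear_scaleR_right]
        MM_pow_C_u_diff MM_pow_C_u_shift continuous_on_diff ck ch) auto
    moreover have "Mean h (D (Suc k)) = (\<lambda>x. (1 / h) *\<^sub>R (D k (x + h) - D k x))"
      using W_loc_derivs_Mean[OF W _ h, of k] Suc.prems by (intro ext) simp
    ultimately show ?thesis by simp
  qed
  then show ?case using c[OF Suc.prems] by (simp add: MM_pow_Suc_continuous)
qed

text \<open>The equation integrated over \<open>[x, x + h]\<close>; \<open>C\<close> collects the terms of lower order.\<close>

lemma solution_difference:
  fixes D :: "nat \<Rightarrow> real \<Rightarrow> 'x::complex_banach ^ 'r"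
  assumes W: "W_loc_derivs (Suc n) y D" and f: "f \<in> L1_loc" and C: "continuous_on UNIV C"
    and ae: "AE x in lebesgue. f x = A *\<^sub>M D (Suc n) x + C x" and h: "h > 0"
  shows "A *\<^sub>M (D n (x + h) - D n x) = h *\<^sub>R Mean h f x - h *\<^sub>R Mean h C x"
proof -
  have "D (Suc n) \<in> L1_loc" using W by (simp add: W_loc_derivs_def)
  from has_Bochner_int_Mean[OF this h, of x]
  have "has_Bochner_int (lebesgue_on {x..x + h}) (D (Suc n)) (D n (x + h) - D n x)"
    using W_loc_derivs_Mean[OF W _ h, of n x] h by simp
  then have "has_Bochner_int (lebesgue_on {x..x + h}) (\<lambda>x. A *\<^sub>M D (Suc n) x) (A *\<^sub>M (D n (x + h) - D n x))"
    by (rule has_Bochner_int_bounded_linear[OF bounded_linear_mat_act])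
  moreover have "AE x in lebesgue_on {x..x + h}. f x = A *\<^sub>M D (Suc n) x + C x"
    using ae by (subst AE_restrict_space_iff) (auto elim: eventually_mono)
  ultimately have "h *\<^sub>R Mean h f x = A *\<^sub>M (D n (x + h) - D n x) + h *\<^sub>R Mean h C x"
    using has_Bochner_int_add_AE has_Bochner_int_Mean f C h continuous_imp_L1_loc by blast
  then show ?thesis by simp
qed

text \<open>The exponent \<open>p\<close> of the class \<open>MM_pow p C_u\<close> containing all derivatives of order below \<open>n\<close> is lowered
  step by step from \<open>s + n\<close> to \<open>0\<close>. Lowering it for all orders simultaneously is what makes the
  descent work, as the difference of one derivative is controlled by the means of others.\<close>

lemma solution_derivs_C_u:
  fixes D :: "nat \<Rightarrow> real \<Rightarrow> 'x::complex_banach ^ 'r"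
  assumes W: "W_loc_derivs n y D" and n: "n \<ge> 1"
    and y: "y \<in> MM_pow s C_u" and f: "f \<in> MM C_u" and A: "det A \<noteq> 0"
    and ae: "AE x in lebesgue. f x = A *\<^sub>M D n x + (\<Sum>k<n. \<Sum>j\<in>J. b j k *\<^sub>M D k (x + t j))"
    and k: "k < n"
  shows "D k \<in> C_u"
proof -
  note c = W_loc_derivs_continuous[OF W]
  have cs: "continuous_on UNIV (\<lambda>x. D k (x + u))" if "k < n" for k u
    by (auto intro!: continuous_intros continuous_on_compose2[OF c[OF that]])
  obtain B where B: "\<And>v :: 'x ^ 'r. B *\<^sub>M A *\<^sub>M v = v"
    using mat_act_left_inverse[OF A] by blast
  define C where "C x = (\<Sum>k<n. \<Sum>j\<in>J. b j k *\<^sub>M D k (x + t j))" for x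
  have C_cont: "continuous_on UNIV C"
    unfolding C_def
    by (intro continuous_on_sum bounded_linear.continuous_on[OF bounded_linear_mat_act] cs) simp
  obtain n' where n': "n = Suc n'" using n by (cases n) auto
  have descend: "\<forall>k<n. D k \<in> MM_pow p C_u" if IH: "\<forall>k<n. D k \<in> MM_pow (Suc p) C_u" for p
  proof (intro allI impI)
    fix k assume k: "k < n"
    have "C \<in> MM_pow (Suc p) C_u"
      unfolding C_def using IH
      by (intro MM_pow_C_u_sum continuous_on_sum bounded_linear.continuous_on[OF bounded_linear_mat_act]
          MM_pow_C_u_bounded_linear[OF bounded_linear_mat_act] MM_pow_C_u_shift cs c) auto
    then have MC: "Mean h C \<in> MM_pow p C_u" if "h > 0" for h
      using C_cont that by (simp add: MM_pow_Suc_continuous)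
    have Mf: "Mean h f \<in> C_u" if "h > 0" for h
      using f that by (simp add: MM_def)
    have Mf': "Mean h f \<in> MM_pow p C_u" if "h > 0" for h
      using Mf[OF that] by (intro MM_pow_C_u_mono[of 0 p]) (simp_all add: C_u_continuous MM_pow_0_continuous)
    show "D k \<in> MM_pow p C_u"
    proof (rule MM_pow_C_u_of_differences)
      show "continuous_on UNIV (D k)" "D k \<in> MM_pow (Suc p) C_u" using c IH k by auto
      fix h :: real assume h: "h > 0"
      show "(\<lambda>x. D k (x + h) - D k x) \<in> MM_pow p C_u"
      proof (cases "Suc k < n")
        case True
        have "D k (x + h) - D k x = h *\<^sub>R Mean h (D (Suc k)) x" for x
          using W_loc_derivs_Mean[OF W k h] h by simp
        moreover have "Mean h (D (Suc k)) \<in> MM_pow p C_u"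
          using IH True h c by (simp add: MM_pow_Suc_continuous)
        then have "(\<lambda>x. h *\<^sub>R Mean h (D (Suc k)) x) \<in> MM_pow p C_u"
          by (intro MM_pow_C_u_bounded_linear[OF bounded_linear_scaleR_right] continuous_Mean c True)
        ultimately show ?thesis by simp
      next
        case False
        then have "k = n'" using k n' by simp
        have "A *\<^sub>M (D k (x + h) - D k x) = h *\<^sub>R Mean h f x - h *\<^sub>R Mean h C x" for x
          using solution_difference[of n' y D f C A h x] W f C_cont ae h
          by (simp add: n' \<open>k = n'\<close> C_def[abs_def] MM_def)
        then have "D k (x + h) - D k x = B *\<^sub>M (h *\<^sub>R Mean h f x - h *\<^sub>R Mean h C x)" for x
          by (metis B)
        moreover have "(\<lambda>x. B *\<^sub>M (h *\<^sub>R Mean h f x - h *\<^sub>R Mean h C x)) \<in> MM_pow p C_u"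
          using Mf[OF h, THEN C_u_continuous] continuous_Mean[OF C_cont]
          by (intro MM_pow_C_u_bounded_linear[OF bounded_linear_mat_act] MM_pow_C_u_diff
              MM_pow_C_u_bounded_linear[OF bounded_linear_scaleR_right] Mf' MC h
              continuous_on_diff continuous_on_scaleR continuous_on_const)
        ultimately show ?thesis by simp
      qed
    qed
  qed
  have "\<forall>k<n. D k \<in> MM_pow (s + n) C_u"
    using W_loc_derivs_MM_pow[OF W y] MM_pow_C_u_mono c
    by (meson add_left_mono less_imp_le)
  then have "\<forall>k<n. D k \<in> MM_pow 0 C_u"
    by (rule inc_induct[OF le0]) (rule descend)
  then show ?thesis using c k by (simp add: MM_pow_0_continuous)
qed

theorem proposition5p6:
  fixes m n s s' j0 :: nat
    and t :: "nat \<Rightarrow> real"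
    and a :: "nat \<Rightarrow> nat \<Rightarrow> complex ^ 'r ^ 'r"
    and f y :: "real \<Rightarrow> 'x::complex_banach ^ 'r"
    and D :: "nat \<Rightarrow> real \<Rightarrow> 'x ^ 'r"
  assumes "m \<ge> 1" and "n \<ge> 1"
    and "strict_mono_on {1..m} t"
    and "\<exists>x::real. det (\<chi> p q. \<Sum>j = 1..m. a j n $ p $ q * exp (\<i> * of_real (t j * x))) \<noteq> 0"
    and "j0 \<in> {1..m}" and "t j0 = 0"
    and "\<And>j. j \<in> {1..m} \<Longrightarrow> j \<noteq> j0 \<Longrightarrow> a j n = 0"
    and "is_solution n m t a f y D"
    and "f \<in> MM C_u"
    and "y \<in> MM_pow s C_u \<inter> MM_pow s' REC"
  shows "(\<forall>k<n. D k \<in> REC) \<and> D n \<in> MM REC"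
proof -
  let ?A = "a j0 n"
  have W: "W_loc_derivs n y D" using assms(8) by (simp add: is_solution_def)
  \<comment> \<open>a sum over all delays that involves only coefficients of order \<open>n\<close> reduces to the undelayed term\<close>
  have top: "(\<Sum>j = 1..m. g j (a j n)) = g j0 ?A" if "\<And>j. g j 0 = 0" for g :: "nat \<Rightarrow> _ \<Rightarrow> 'b::comm_monoid_add"
  proof -
    have "(\<Sum>j = 1..m. g j (a j n)) = (\<Sum>j = 1..m. if j = j0 then g j0 ?A else 0)"
      using assms(7) that by (intro sum.cong) auto
    then show ?thesis using assms(5) by simp
  qed
  have "(\<Sum>j = 1..m. a j n $ p $ q * exp (\<i> * of_real (t j * x))) = ?A $ p $ q" for p q x
    using top[of "\<lambda>j M. M $ p $ q * exp (\<i> * of_real (t j * x))"] assms(6) by simp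
  then have A: "det ?A \<noteq> 0" using assms(4) by simp
  have "AE x in lebesgue. (\<Sum>k = 0..n. \<Sum>j = 1..m. a j k *\<^sub>M D k (x + t j)) = f x"
    using assms(8) by (simp add: is_solution_def)
  then have "AE x in lebesgue. f x = ?A *\<^sub>M D n x + (\<Sum>k<n. \<Sum>j\<in>{1..m}. a j k *\<^sub>M D k (x + t j))"
  proof eventually_elim
    case (elim x)
    have "(\<Sum>j = 1..m. a j n *\<^sub>M D n (x + t j)) = ?A *\<^sub>M D n x"
      using top[of "\<lambda>j M. M *\<^sub>M D n (x + t j)"] assms(6) by (simp add: mat_act_0)
    moreover have "(\<Sum>k = 0..n. g k) = (\<Sum>k<n. g k) + g n" for g :: "nat \<Rightarrow> 'x ^ 'r"
      by (simp add: atLeast0AtMost lessThan_Suc_atMost[symmetric])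
    ultimately show ?case using elim by (simp add: add.commute)
  qed
  from solution_derivs_C_u[OF W assms(2) _ assms(9) A this]
  have C: "D k \<in> C_u" if "k < n" for k using assms(10) that by blast
  have means: "Mean h (D (Suc k)) \<in> REC" if "D k \<in> REC" "k < n" "h > 0" for k h
  proof -
    have "Mean h (D (Suc k)) = (\<lambda>x. (1 / h) *\<^sub>R (D k (x + h) - D k x))"
      using W_loc_derivs_Mean[OF W that(2,3)] by blast
    then show ?thesis using REC_difference[OF that(1)] by simp
  qed
  have R: "D k \<in> REC" if "k < n" for k
    using that
  proof (induction k)
    case 0
    have "D 0 = y" using W by (simp add: W_loc_derivs_def)
    then show ?case using C[OF 0] assms(10) REC_of_MM_pow by blast
  next
    case (Suc k)
    then show ?case
      using REC_of_means[OF C[OF Suc.prems]] means[of k] by simp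
  qed
  obtain n' where n': "n = Suc n'" using assms(2) by (cases n) auto
  have "D n \<in> L1_loc" using W by (simp add: W_loc_derivs_def)
  then have "D n \<in> MM REC" using means[of n'] R[of n'] by (simp add: MM_def n')
  then show ?thesis using R by blast
qed

end
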